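(* Let $p\in(0,1)$, $\lambda\in(0,1]$, and let $f\in\mathcal{A}(p)$ be such that $z/f$ has the expansion $$\frac{z}{f(z)}=1+b_1z+b_2z^2+\cdots,\qquad z\in\mathbb{D}.$$ If $f$ satisfies any one of the following three conditions: (i) $\displaystyle\sum_{n=2}^{\infty}(n-1)|b_n|\le\lambda$; (ii) $\displaystyle\sum_{n=2}^{\infty}n(n-1)|b_n|\le 2\lambda$; (iii) for some integer $n\ge 3$, $\displaystyle\sum_{k=2}^{n}(k-1)|b_k|+(n-1)\sum_{k=n+1}^{\infty}\binom{k}{n}|b_k|\le\lambda$; then $f\in\mathcal{V}_p(\lambda)$.
   Context: $\mathbb{D}=\{z\in\mathbb{C}:|z|<1\}$. For $p\in(0,1)$, $\mathcal{A}(p)$ is the class of all functions $f$ that are holomorphic in $\mathbb{D}\setminus\{p\}$, have a simple pole at $z=p$ (with nonzero residue), and satisfy $f(0)=0$ and $f'(0)=1$. The function $z/f(z)$ is understood with its removable singularities filled in (value $1$ at $z=0$ and $0$ at $z=p$). For $f\in\mathcal{A}(p)$ put $U_f(z)=\left(\frac{z}{f(z)}\right)^2 f'(z)-1$, regarded as a meromorphic function on $\mathbb{D}$ with removable singularities (in particular at $z=0$ and $z=p$) filled in; a bound $|U_f(z)|<c$ for all $z\in\mathbb{D}$ includes the requirement that $U_f$ has no poles in $\mathbb{D}$. For $\lambda\in(0,1]$, $\mathcal{V}_p(\lambda)=\{f\in\mathcal{A}(p): |U_f(z)|<\lambda \text{ for all } z\in\mathbb{D}\}$. *)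

theory Defs
  imports "HOL-Complex_Analysis.Complex_Analysis"
begin

text \<open>
  The value of \<open>f\<close> at the pole \<open>p\<close> and outside the unit disc is immaterial.
  A pole of order one automatically has nonzero residue.
\<close>

definition class_A :: "real \<Rightarrow> (complex \<Rightarrow> complex) set" where
  "class_A p = {f. f holomorphic_on ball 0 1 - {of_real p}
                 \<and> is_pole f (of_real p) \<and> zorder f (of_real p) = - 1
                 \<and> f 0 = 0 \<and> deriv f 0 = 1}"

definition z_over :: "(complex \<Rightarrow> complex) \<Rightarrow> complex \<Rightarrow> complex" where
  "z_over f = remove_sings (\<lambda>z. z / f z)"

definition U :: "(complex \<Rightarrow> complex) \<Rightarrow> complex \<Rightarrow> complex" where
  "U f = remove_sings (\<lambda>z. (z / f z)\<^sup>2 * deriv f z - 1)"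

text \<open>
  \<^const>\<open>remove_sings\<close> assigns the value \<open>0\<close> at poles, so their absence has to be
  required separately from the bound.
\<close>

definition class_V :: "real \<Rightarrow> real \<Rightarrow> (complex \<Rightarrow> complex) set" where
  "class_V p l = {f \<in> class_A p. \<forall>z\<in>ball 0 1. \<not> is_pole (U f) z \<and> norm (U f z) < l}"

text \<open>
  Real-valued infinite sums of divergent families are \<open>0\<close> by convention, so an upper bound
  on a series of nonnegative terms must include its convergence.
\<close>

definition coeff_cond_1 :: "real \<Rightarrow> (nat \<Rightarrow> complex) \<Rightarrow> bool" where
  "coeff_cond_1 l b \<longleftrightarrow>
     (\<lambda>n. (real n - 1) * norm (b n)) summable_on {2..} \<and>
     (\<Sum>\<^sub>\<infinity>n\<in>{2..}. (real n - 1) * norm (b n)) \<le> l"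

definition coeff_cond_2 :: "real \<Rightarrow> (nat \<Rightarrow> complex) \<Rightarrow> bool" where
  "coeff_cond_2 l b \<longleftrightarrow>
     (\<lambda>n. real n * (real n - 1) * norm (b n)) summable_on {2..} \<and>
     (\<Sum>\<^sub>\<infinity>n\<in>{2..}. real n * (real n - 1) * norm (b n)) \<le> 2 * l"

definition coeff_cond_3 :: "real \<Rightarrow> (nat \<Rightarrow> complex) \<Rightarrow> bool" where
  "coeff_cond_3 l b \<longleftrightarrow> (\<exists>n\<ge>3.
     (\<lambda>k. real (k choose n) * norm (b k)) summable_on {n+1..} \<and>
     (\<Sum>k=2..n. (real k - 1) * norm (b k))
       + (real n - 1) * (\<Sum>\<^sub>\<infinity>k\<in>{n+1..}. real (k choose n) * norm (b k)) \<le> l)"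

end

theory Submission
  imports Defs
begin

text \<open>
  Writing \<open>g = z/f\<close>, one has \<open>f g = z\<close>, so \<open>f\<close> vanishes only at the origin and
  \<open>U\<^sub>f = g - z g' - 1 = - (\<Sum>n\<ge>2. (n - 1) b\<^sub>n z\<^sup>n)\<close>. Under condition (i) this gives
  \<open>|U\<^sub>f(z)| \<le> \<lambda> |z|\<^sup>2 < \<lambda>\<close>. Conditions (ii) and (iii) imply (i), because \<open>n \<ge> 2\<close> and
  because \<open>k choose n \<ge> k\<close> for \<open>0 < n < k\<close>.
\<close>

lemma coeff_cond_2_imp_1:
  assumes "coeff_cond_2 l b"
  shows "coeff_cond_1 l b"
proof -
  let ?g = "\<lambda>n. real n * (real n - 1) * norm (b n)"
  have le: "(real n - 1) * norm (b n) \<le> ?g n / 2" if "n \<in> {2..}" for n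
  proof -
    have "2 * ((real n - 1) * norm (b n)) \<le> real n * ((real n - 1) * norm (b n))"
      using that by (intro mult_right_mono) auto
    then show ?thesis by simp
  qed
  have s: "(\<lambda>n. ?g n / 2) summable_on {2..}"
    using assms summable_on_cmult_left[of ?g "{2..}" "1 / 2"] by (simp add: coeff_cond_2_def)
  have s1: "(\<lambda>n. (real n - 1) * norm (b n)) summable_on {2..}"
    by (rule summable_on_comparison_test[OF s]) (use le in auto)
  have "(\<Sum>\<^sub>\<infinity>n\<in>{2..}. (real n - 1) * norm (b n)) \<le> (\<Sum>\<^sub>\<infinity>n\<in>{2..}. ?g n / 2)"
    by (rule infsum_mono[OF s1 s le])
  also have "\<dots> = (\<Sum>\<^sub>\<infinity>n\<in>{2..}. ?g n) / 2"
    using infsum_cmult_left'[of ?g "1 / 2" "{2..}"] by simp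
  also have "\<dots> \<le> l" using assms by (simp add: coeff_cond_2_def)
  finally show ?thesis using s1 by (simp add: coeff_cond_1_def)
qed

text \<open>Induction by Pascal's rule: away from the edges, \<open>Suc k choose Suc m\<close> is
  the sum of \<open>k choose m\<close>, at least 1, and \<open>k choose Suc m\<close>, at least
  \<open>k\<close> by induction.\<close>

lemma binomial_ge_self:
  fixes n k :: nat
  assumes "0 < n" "n < k"
  shows "k \<le> k choose n"
  using assms
proof (induction k arbitrary: n)
  case (Suc k)
  then obtain m where m: "n = Suc m" by (cases n) auto
  show ?case
  proof (cases "m = 0 \<or> n = k")
    case True
    \<comment> \<open>At both edges the coefficient is exactly \<open>Suc k\<close>: it is
      \<open>Suc k choose 1\<close>, directly or by symmetry.\<close>
    then show ?thesis using m by (auto simp: binomial_symmetric[of k "Suc k"])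
  next
    case False
    then have "k \<le> k choose n" "1 \<le> k choose m"
      using Suc.IH[of n] Suc.prems m zero_less_binomial[of m k] by linarith+
    then show ?thesis using m by simp
  qed
qed simp

text \<open>The terms up to \<open>n\<close> are the same in both conditions, so only the tails
  beyond \<open>n\<close> are compared, term by term.\<close>

lemma coeff_cond_3_imp_1:
  assumes "coeff_cond_3 l b"
  shows "coeff_cond_1 l b"
proof -
  let ?h = "\<lambda>k. (real k - 1) * norm (b k)"
  obtain n where n: "n \<ge> 3"
    and s: "(\<lambda>k. real (k choose n) * norm (b k)) summable_on {n+1..}"
    and bound: "(\<Sum>k=2..n. ?h k)
       + (real n - 1) * (\<Sum>\<^sub>\<infinity>k\<in>{n+1..}. real (k choose n) * norm (b k)) \<le> l"
    using assms by (auto simp: coeff_cond_3_def)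
  let ?g = "\<lambda>k. (real n - 1) * (real (k choose n) * norm (b k))"
  have le: "?h k \<le> ?g k" if "k \<in> {n+1..}" for k
  proof -
    have "k \<le> k choose n"
      by (rule binomial_ge_self) (use that n in auto)
    \<comment> \<open>The factor \<open>1\<close> is there to be bounded by
      \<open>real n - 1\<close>, while \<open>real k - 1\<close> is bounded by the binomial
      coefficient.\<close>
    then have "1 * (real k - 1) \<le> (real n - 1) * real (k choose n)"
      using n that by (intro mult_mono) auto
    then have "(real k - 1) * norm (b k) \<le> ((real n - 1) * real (k choose n)) * norm (b k)"
      by (intro mult_right_mono) auto
    then show ?thesis by (simp add: mult.assoc)
  qed
  have sg: "?g summable_on {n+1..}" by (rule summable_on_cmult_right[OF s])
  have sh: "?h summable_on {n+1..}"
    by (rule summable_on_comparison_test[OF sg]) (use le in auto)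
  have "infsum ?h {n+1..} \<le> infsum ?g {n+1..}"
    by (rule infsum_mono[OF sh sg le])
  also have "\<dots> = (real n - 1) * (\<Sum>\<^sub>\<infinity>k\<in>{n+1..}. real (k choose n) * norm (b k))"
    by (rule infsum_cmult_right')
  finally have tail: "infsum ?h {n+1..} \<le> \<dots>" .
  have un: "{2..} = {2..n} \<union> {n+1..}" using n by auto
  have "?h summable_on {2..}"
    unfolding un by (intro summable_on_Un_disjoint sh summable_on_finite) auto
  moreover have "infsum ?h {2..} = (\<Sum>k=2..n. ?h k) + infsum ?h {n+1..}"
    unfolding un by (subst infsum_Un_disjoint) (auto intro: sh[simplified])
  ultimately show ?thesis using tail bound by (simp add: coeff_cond_1_def)
qed

text \<open>Shifting the index by 2 turns the unordered sum over \<open>{2..}\<close> into an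
  ordinary series, to which the norm estimate for \<open>suminf\<close> applies.\<close>

lemma coeff_cond_1_sums:
  assumes "coeff_cond_1 l b"
  shows "summable (\<lambda>n. (real n + 1) * norm (b (n + 2)))"
    and "(\<Sum>n. (real n + 1) * norm (b (n + 2))) \<le> l"
proof -
  let ?h = "\<lambda>n. (real n - 1) * norm (b n)" and ?S = "\<lambda>n. (real n + 1) * norm (b (n + 2))"
  have bij: "bij_betw (\<lambda>n::nat. n + 2) UNIV {2..}"
    by (rule bij_betwI[of _ _ _ "\<lambda>n. n - 2"]) auto
  have "(?h has_sum infsum ?h {2..}) {2..}"
    using assms by (intro has_sum_infsum) (simp add: coeff_cond_1_def)
  then have "((\<lambda>n. ?h (n + 2)) has_sum infsum ?h {2..}) UNIV"
    using has_sum_reindex_bij_betw[OF bij, of ?h] by simp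
  then have "?S sums infsum ?h {2..}"
    by (auto dest!: has_sum_imp_sums simp: add.commute)
  then show "summable ?S" "suminf ?S \<le> l"
    using assms by (auto simp: coeff_cond_1_def sums_iff)
qed

text \<open>Termwise differentiation is allowed inside the disc of convergence, and
  \<open>z * deriv g z\<close> multiplies the \<open>n\<close>-th coefficient by
  \<open>n\<close>.\<close>

lemma power_series_minus_z_deriv_sums:
  fixes g :: "complex \<Rightarrow> complex"
  assumes g: "\<And>z. z \<in> ball 0 1 \<Longrightarrow> (\<lambda>n. b n * z ^ n) sums g z"
    and z: "z \<in> ball 0 1"
  shows "g field_differentiable at z"
    and "(\<lambda>n. (1 - of_nat n) * b n * z ^ n) sums (g z - z * deriv g z)"
proof -
  have summ: "summable (\<lambda>n. b n * w ^ n)" if "norm w < 1" for w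
    using g[of w] that by (simp add: sums_iff)
  have nz: "norm z < 1" using z by simp
  have "((\<lambda>w. \<Sum>n. b n * w ^ n) has_field_derivative (\<Sum>n. diffs b n * z ^ n)) (at z)"
    by (rule termdiffs_strong'[OF summ nz])
  then have D: "(g has_field_derivative (\<Sum>n. diffs b n * z ^ n)) (at z)"
    by (rule has_field_derivative_transform_within_open[OF _ open_ball z])
       (use g in \<open>simp add: sums_iff\<close>)
  then show "g field_differentiable at z" by (auto simp: field_differentiable_def)
  have "summable (\<lambda>n. diffs b n * z ^ n)"
    by (rule termdiff_converges[OF nz summ])
  then have "(\<lambda>n. of_nat n * b n * z ^ (n - Suc 0)) sums deriv g z"
    using diffs_equiv D by (metis DERIV_imp_deriv)
  then have "(\<lambda>n. z * (of_nat n * b n * z ^ (n - Suc 0))) sums (z * deriv g z)"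
    by (rule sums_mult)
  also have "(\<lambda>n. z * (of_nat n * b n * z ^ (n - Suc 0))) = (\<lambda>n. of_nat n * b n * z ^ n)"
  proof
    \<comment> \<open>At \<open>n = 0\<close> the truncated exponent is harmless, since the factor
      \<open>of_nat n\<close> vanishes.\<close>
    show "z * (of_nat n * b n * z ^ (n - Suc 0)) = of_nat n * b n * z ^ n" for n
      by (cases n) auto
  qed
  finally have "(\<lambda>n. b n * z ^ n - of_nat n * b n * z ^ n) sums (g z - z * deriv g z)"
    by (intro sums_diff g z)
  then show "(\<lambda>n. (1 - of_nat n) * b n * z ^ n) sums (g z - z * deriv g z)"
    by (simp add: algebra_simps)
qed

text \<open>The identity is clear where \<open>f\<close> is nonzero and spreads over the connected
  punctured disc by analytic continuation. In particular \<open>f\<close> has no zero there except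
  the origin.\<close>

lemma mult_z_over:
  assumes f: "f holomorphic_on ball 0 1 - {p}" and p: "p \<noteq> 0"
    and nz: "deriv f 0 \<noteq> 0"
    and g: "z_over f holomorphic_on ball 0 1"
    and z: "z \<in> ball 0 1 - {p}"
  shows "f z * z_over f z = z"
proof -
  let ?D = "ball 0 1 - {p} :: complex set"
  have op: "open ?D" by (intro open_delete) auto
  have conn: "connected ?D" by (intro connected_open_delete) auto
  have "\<exists>w\<in>?D. f w \<noteq> 0"
  \<comment> \<open>As \<open>p\<close> is not 0, the punctured disc is a neighbourhood of 0, so
    vanishing on all of it would force \<open>deriv f 0 = 0\<close>.\<close>
  proof (rule ccontr)
    assume "\<not> (\<exists>w\<in>?D. f w \<noteq> 0)"
    then have "deriv f 0 = deriv (\<lambda>_. 0) 0"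
      using p op by (intro deriv_cong_ev eventually_nhds_in_open[THEN eventually_mono, of ?D]) auto
    with nz show False by simp
  qed
  then obtain w where w: "w \<in> ?D" "f w \<noteq> 0" by blast
  define S where "S = {x \<in> ?D. f x \<noteq> 0}"
  have "S = ?D \<inter> f -` (- {0})" by (auto simp: S_def)
  then have opS: "open S"
    using continuous_open_preimage[OF holomorphic_on_imp_continuous_on[OF f] op, of "- {0}"] by auto
  have "f z * z_over f z - z = 0"
  proof (rule analytic_continuation_open[OF opS op _ conn _ _ _ _ z, where g = "\<lambda>_. 0"])
    show "(\<lambda>x. f x * z_over f x - x) holomorphic_on ?D"
      by (intro holomorphic_intros f holomorphic_on_subset[OF g]) auto
    fix x assume x: "x \<in> S"
    have "f holomorphic_on S" by (rule holomorphic_on_subset[OF f]) (auto simp: S_def)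
    then have "(\<lambda>z. z / f z) holomorphic_on S"
      by (intro holomorphic_intros) (auto simp: S_def)
    then have "(\<lambda>z. z / f z) analytic_on {x}"
      using opS x by (meson analytic_at)
    then have "z_over f x = x / f x" by (simp add: z_over_def)
    then show "f x * z_over f x - x = 0" using x by (simp add: S_def)
  qed (use w in \<open>auto simp: S_def\<close>)
  then show ?thesis by simp
qed

text \<open>Away from 0 and \<open>p\<close>, differentiate \<open>f g = z\<close> and multiply by
  \<open>g\<close>: this gives \<open>g^2 f' + z g' = g\<close>. Since \<open>remove_sings\<close>
  depends only on a punctured neighbourhood, the formula then holds at 0 and \<open>p\<close>
  too.\<close>

lemma U_eq:
  assumes f: "f holomorphic_on ball 0 1 - {p}" and p: "p \<noteq> 0"
    and nz: "deriv f 0 \<noteq> 0"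
    and g: "z_over f holomorphic_on ball 0 1"
    and z: "z \<in> ball 0 1"
  shows "U f z = z_over f z - z * deriv (z_over f) z - 1"
proof -
  let ?g = "z_over f"
  let ?H = "\<lambda>z. ?g z - z * deriv ?g z - 1"
  have op: "open (ball 0 1 - {p})" by (intro open_delete) auto
  have eq: "(w / f w)\<^sup>2 * deriv f w - 1 = ?H w" if w: "w \<in> ball 0 1 - {0, p}" for w
  proof -
    have w': "w \<in> ball 0 1 - {p}" using w by auto
    note fg = mult_z_over[OF f p nz g]
    have fgw: "f w * ?g w = w" by (rule fg[OF w'])
    have "f w \<noteq> 0" using fgw w by auto
    then have quot: "w / f w = ?g w" using fgw by (simp add: field_simps)
    have df: "(f has_field_derivative deriv f w) (at w)"
      by (rule holomorphic_derivI[OF f op w'])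
    have dg: "(?g has_field_derivative deriv ?g w) (at w)"
      by (rule holomorphic_derivI[OF g open_ball]) (use w in auto)
    have "((\<lambda>x. f x * ?g x) has_field_derivative deriv f w * ?g w + deriv ?g w * f w) (at w)"
      by (rule DERIV_mult[OF df dg])
    then have "((\<lambda>x. x) has_field_derivative deriv f w * ?g w + deriv ?g w * f w) (at w)"
      by (rule has_field_derivative_transform_within_open[OF _ op w']) (rule fg)
    then have "deriv f w * ?g w + deriv ?g w * f w = 1"
      using DERIV_ident DERIV_unique by blast
    then have "?g w * (deriv f w * ?g w + deriv ?g w * f w) = ?g w" by simp
    then have "(?g w)\<^sup>2 * deriv f w + (f w * ?g w) * deriv ?g w = ?g w"
      by (simp add: algebra_simps power2_eq_square)
    then show ?thesis unfolding quot fgw by (simp add: algebra_simps)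
  qed
  \<comment> \<open>Taking \<open>z\<close> out of the exceptional set treats \<open>z = 0\<close>,
    \<open>z = p\<close> and all other points at once, because the filter \<open>at z\<close>
    ignores \<open>z\<close> itself.\<close>
  have "open (ball 0 1 - ({0, p} - {z}))"
    by (intro open_Diff open_ball finite_imp_closed) simp
  then have "\<forall>\<^sub>F w in at z. w \<in> ball 0 1 - ({0, p} - {z}) - {z}"
    by (rule eventually_at_in_open) (use z in simp)
  then have "\<forall>\<^sub>F w in at z. (w / f w)\<^sup>2 * deriv f w - 1 = ?H w"
    by (rule eventually_mono) (use eq in auto)
  then have "U f z = remove_sings ?H z"
    unfolding U_def by (rule remove_sings_cong) simp
  also have "?H holomorphic_on ball 0 1"
    by (intro holomorphic_intros g holomorphic_deriv open_ball)
  then have "?H analytic_on {z}" using z by (meson analytic_at open_ball)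
  then have "remove_sings ?H z = ?H z" by (rule remove_sings_at_analytic)
  finally show ?thesis .
qed

text \<open>Here \<open>h\<close> stands for the value of \<open>U f\<close> at \<open>z\<close>.
  Its series starts at degree 2, so \<open>(norm z)^2\<close> can be factored out.\<close>

lemma norm_le_of_coeff_cond_1:
  assumes c: "coeff_cond_1 l b" and b: "b 0 = 1" and z: "norm z < 1"
    and s: "(\<lambda>n. (1 - of_nat n) * b n * z ^ n) sums (h + 1)"
  shows "norm h \<le> l * (norm z)\<^sup>2"
proof -
  let ?S = "\<lambda>n. (real n + 1) * norm (b (n + 2))"
  note S = coeff_cond_1_sums[OF c]
  let ?t = "\<lambda>n. (1 - of_nat (n + 2)) * b (n + 2) * z ^ (n + 2)"
  \<comment> \<open>The term of index 0 is \<open>b 0 = 1\<close> and cancels the 1 in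
    \<open>h + 1\<close>; the term of index 1 has coefficient 0.\<close>
  have t: "?t sums h"
    using sums_split_initial_segment[OF s, of 2] b by (simp add: numeral_2_eq_2)
  have le: "norm (?t n) \<le> ?S n * (norm z)\<^sup>2" for n
  proof -
    have "norm (1 - of_nat (n + 2) :: complex) = norm (- of_nat (n + 1) :: complex)"
      by (rule arg_cong[of _ _ norm]) simp
    also have "\<dots> = real n + 1"
      unfolding norm_minus_cancel norm_of_nat by simp
    finally have "norm (?t n) = ?S n * norm z ^ (n + 2)"
      by (simp only: norm_mult norm_power)
    also have "\<dots> \<le> ?S n * (norm z)\<^sup>2"
      using z by (intro mult_left_mono power_decreasing) auto
    finally show ?thesis .
  qed
  have sS: "summable (\<lambda>n. ?S n * (norm z)\<^sup>2)" by (rule summable_mult2[OF S(1)])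
  have "norm h = norm (suminf ?t)" using t by (simp add: sums_iff)
  also have "\<dots> \<le> (\<Sum>n. ?S n * (norm z)\<^sup>2)"
    by (rule norm_suminf_le[OF le sS])
  also have "\<dots> = suminf ?S * (norm z)\<^sup>2" by (rule suminf_mult2[OF S(1), symmetric])
  also have "\<dots> \<le> l * (norm z)\<^sup>2" by (intro mult_right_mono S(2)) auto
  finally show ?thesis .
qed

theorem theorem4:
  fixes p l :: real and f :: "complex \<Rightarrow> complex" and b :: "nat \<Rightarrow> complex"
  assumes "0 < p" "p < 1" and "0 < l" "l \<le> 1"
    and "f \<in> class_A p"
    and "b 0 = 1"
    and "\<And>z. z \<in> ball 0 1 \<Longrightarrow> (\<lambda>n. b n * z ^ n) sums z_over f z"
    and "coeff_cond_1 l b \<or> coeff_cond_2 l b \<or> coeff_cond_3 l b"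
  shows "f \<in> class_V p l"
proof -
  let ?g = "z_over f"
  let ?H = "\<lambda>z. ?g z - z * deriv ?g z - 1"
  have c: "coeff_cond_1 l b"
    using assms(8) coeff_cond_2_imp_1 coeff_cond_3_imp_1 by blast
  note series = power_series_minus_z_deriv_sums[where g = ?g and b = b, OF assms(7)]
  \<comment> \<open>The convergent expansion makes \<open>z_over f\<close> holomorphic on the whole
    disc, including at \<open>p\<close>.\<close>
  have g: "?g holomorphic_on ball 0 1"
    unfolding holomorphic_on_def
    using series(1) field_differentiable_at_within by blast
  have f: "f holomorphic_on ball 0 1 - {of_real p}" and "deriv f 0 \<noteq> 0"
    using assms(5) by (auto simp: class_A_def)
  then have U: "U f z = ?H z" if "z \<in> ball 0 1" for z
    using U_eq[OF f _ _ g that] assms(1) by simp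
  \<comment> \<open>Absence of poles comes from holomorphy of \<open>U f\<close>; the norm bound
    alone would not show it.\<close>
  have "?H holomorphic_on ball 0 1"
    by (intro holomorphic_intros g holomorphic_deriv open_ball)
  then have "U f holomorphic_on ball 0 1"
    by (rule holomorphic_transform) (simp add: U)
  then have "\<not> is_pole (U f) z" if "z \<in> ball 0 1" for z
    using not_is_pole_holomorphic[OF open_ball that] by blast
  moreover have "norm (U f z) < l" if z: "z \<in> ball 0 1" for z
  proof -
    have "norm (?H z) \<le> l * (norm z)\<^sup>2"
      by (rule norm_le_of_coeff_cond_1[OF c assms(6)]) (use z series(2)[OF _ z] in simp_all)
    \<comment> \<open>Strictness comes from \<open>norm z < 1\<close> together with
      \<open>0 < l\<close>.\<close>
    also have "\<dots> < l * 1"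
      using z assms(3) by (intro mult_strict_left_mono) (auto simp: power_less_one_iff)
    finally show ?thesis using U[OF z] by simp
  qed
  ultimately show ?thesis using assms(5) by (simp add: class_V_def)
qed

end
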